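(* Let $\{\mu_i(x): i\in[n_1]\}$ be a blending basis sequence on $[0,1]$, let $x_0<x_1<\cdots<x_m$ be a real increasing sequence in $[0,1]$, let $\boldsymbol q_0,\dots,\boldsymbol q_m\in\mathbb R^d$ be data points, $\lambda\ge 0$, $\{U_i\}_{i=0}^t$ a partition of $[n_1]$, and let $\hat{\boldsymbol A}$ be the corresponding augmented collocation matrix and $\hat{\boldsymbol q}$ the augmented data, as defined in the context. Suppose that $\hat{\boldsymbol A}$ has full column rank and that the number of data points is larger than the number of control points (i.e. $m+1>n_1+1$). Then, for arbitrary initial control points $\boldsymbol p^{(0)}\in\mathbb R^{(n_1+1)\times d}$, the sequence of fitting curves $\mathcal C^{(k)}$ generated by the regularized RPIA algorithm for curves converges in expectation to the least-squares fitting solution: if $\boldsymbol p^*=(\hat{\boldsymbol A}^T\hat{\boldsymbol A})^{-1}\hat{\boldsymbol A}^T\hat{\boldsymbol q}$ denotes the least-squares solution of $\hat{\boldsymbol A}\boldsymbol p=\hat{\boldsymbol q}$, then $$\lim_{k\to\infty}\mathbb E[\boldsymbol p^{(k)}]=\boldsymbol p^*,$$ and hence $\lim_{k\to\infty}\mathbb E[\mathcal C^{(k)}(x)]=\sum_{i=0}^{n_1}\mu_i(x)\boldsymbol p_i^*$ for every $x\in[x_0,x_m]$.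
   Context: Notation: $[n]=\{0,1,\dots,n\}$. A partition $\{U_i\}_{i=0}^t$ of $[n_1]$ consists of pairwise disjoint nonempty sets with union $[n_1]$. For a matrix $\boldsymbol M$ and an index set $U$, $\boldsymbol M_{:,U}$ is the submatrix of columns indexed by $U$; $\boldsymbol p_U$ is the sub-block of rows of $\boldsymbol p$ indexed by $U$; $\|\cdot\|_F$ is the Frobenius norm. A blending basis sequence here is a finite sequence of real-valued functions $\mu_i$ on $[0,1]$ (no further property is specified). Data points and control points are vectors in $\mathbb R^d$; they are stacked as rows, so $\boldsymbol q\in\mathbb R^{(m+1)\times d}$ and $\boldsymbol p\in\mathbb R^{(n_1+1)\times d}$. Augmented matrices: $\boldsymbol A\in\mathbb R^{(m+1)\times(n_1+1)}$ is the collocation (design) matrix with entries $\boldsymbol A_{h,i}=\mu_i(x_h)$. $\Gamma$ is a second-order difference matrix of size $(n_1+1)\times(n_1+1)$: there is a constant $C>0$ such that for each $1\le i\le n_1-1$ row $i$ maps $\boldsymbol p$ to $C(\boldsymbol p_{i-1}-2\boldsymbol p_i+\boldsymbol p_{i+1})$, while the first and last rows encode fixed boundary conditions, otherwise unspecified. With regularization parameter $\lambda$, $$\hat{\boldsymbol A}=\begin{bmatrix}\boldsymbol A\\ \sqrt{\lambda}\,\Gamma\end{bmatrix},\qquad \hat{\boldsymbol q}=\begin{bmatrix}\boldsymbol q\\ \boldsymbol 0\end{bmatrix},$$ so that minimizing $\|\hat{\boldsymbol A}\boldsymbol p-\hat{\boldsymbol q}\|_F^2$ is the same as minimizing $\|\boldsymbol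 A\boldsymbol p-\boldsymbol q\|_F^2+\lambda\|\Gamma\boldsymbol p\|_F^2$. Regularized RPIA algorithm for curves: start from (deterministic) control points $\boldsymbol p^{(0)}$. For $k=0,1,2,\dots$, the $k$-th curve is $\mathcal C^{(k)}(x)=\sum_{i=0}^{n_1}\mu_i(x)\boldsymbol p_i^{(k)}$, $x\in[x_0,x_m]$; compute $\boldsymbol r^{(k)}=\hat{\boldsymbol q}-\hat{\boldsymbol A}\boldsymbol p^{(k)}$; draw an index $t_k\in[t]$, independently of previous draws, with $$\mathbb P(t_k=i)=\frac{\|\hat{\boldsymbol A}_{:,U_i}\|_F^2}{\sum_{l=0}^t\|\hat{\boldsymbol A}_{:,U_l}\|_F^2};$$ then update $$\boldsymbol p^{(k+1)}_{U_{t_k}}=\boldsymbol p^{(k)}_{U_{t_k}}+\frac{1}{\|\hat{\boldsymbol A}_{:,U_{t_k}}\|_F^2}\hat{\boldsymbol A}_{:,U_{t_k}}^T\boldsymbol r^{(k)},$$ keeping all other control points unchanged. The iteration is run indefinitely. *)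

theory Defs
  imports
    "HOL-Probability.Probability"
    "Jordan_Normal_Form.DL_Rank"
    "Jordan_Normal_Form.DL_Submatrix"
    "Jordan_Normal_Form.Gauss_Jordan_Elimination"
begin

definition frobenius_norm :: "real mat \<Rightarrow> real" where
  "frobenius_norm A = sqrt (\<Sum>i<dim_row A. \<Sum>j<dim_col A. (A $$ (i, j))\<^sup>2)"

definition full_column_rank :: "real mat \<Rightarrow> bool" where
  "full_column_rank A \<longleftrightarrow> vec_space.rank (dim_row A) A = dim_col A"

(* The sets are U 0, ..., U t; values of U beyond t are irrelevant. *)
definition is_index_partition :: "nat \<Rightarrow> nat \<Rightarrow> (nat \<Rightarrow> nat set) \<Rightarrow> bool" where
  "is_index_partition n t U \<longleftrightarrow>
     (\<forall>i\<le>t. U i \<noteq> {}) \<and> disjoint_family_on U {..t} \<and> (\<Union>i\<le>t. U i) = {..n}"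

definition collocation_matrix ::
    "nat \<Rightarrow> nat \<Rightarrow> (nat \<Rightarrow> real \<Rightarrow> real) \<Rightarrow> (nat \<Rightarrow> real) \<Rightarrow> real mat" where
  "collocation_matrix m n \<mu> x = mat (m + 1) (n + 1) (\<lambda>(h, i). \<mu> i (x h))"

(* Rows 0 and n hold the boundary conditions and are left arbitrary. *)
definition second_difference_matrix :: "nat \<Rightarrow> real mat \<Rightarrow> bool" where
  "second_difference_matrix n \<Gamma> \<longleftrightarrow> \<Gamma> \<in> carrier_mat (n + 1) (n + 1) \<and>
     (\<exists>C>0. \<forall>i. 0 < i \<and> i < n \<longrightarrow> (\<forall>v\<in>carrier_vec (n + 1).
        (\<Gamma> *\<^sub>v v) $ i = C * (v $ (i - 1) - 2 * v $ i + v $ (i + 1))))"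

definition augmented_matrix :: "real \<Rightarrow> real mat \<Rightarrow> real mat \<Rightarrow> real mat" where
  "augmented_matrix lam A \<Gamma> = A @\<^sub>r (sqrt lam \<cdot>\<^sub>m \<Gamma>)"

definition augmented_data :: "nat \<Rightarrow> nat \<Rightarrow> nat \<Rightarrow> (nat \<Rightarrow> real vec) \<Rightarrow> real mat" where
  "augmented_data m n d q = mat_of_rows d (map q [0..<m + 1]) @\<^sub>r 0\<^sub>m (n + 1) d"

(* (A^T A)^{-1} A^T q; mat_inverse yields Some exactly when the Gram matrix is
   invertible, which holds if A has full column rank. *)
definition least_squares_solution :: "real mat \<Rightarrow> real mat \<Rightarrow> real mat" where
  "least_squares_solution A q =
     the (mat_inverse (transpose_mat A * A)) * (transpose_mat A * q)"

definition block_prob :: "real mat \<Rightarrow> (nat \<Rightarrow> nat set) \<Rightarrow> nat \<Rightarrow> nat \<Rightarrow> real" where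
  "block_prob A U t i =
     (frobenius_norm (submatrix A UNIV (U i)))\<^sup>2 /
     (\<Sum>l\<le>t. (frobenius_norm (submatrix A UNIV (U l)))\<^sup>2)"

definition rpia_correction :: "real mat \<Rightarrow> real mat \<Rightarrow> nat set \<Rightarrow> real mat \<Rightarrow> real mat" where
  "rpia_correction A q V p =
     (1 / (frobenius_norm (submatrix A UNIV V))\<^sup>2) \<cdot>\<^sub>m
     (transpose_mat (submatrix A UNIV V) * (q - A * p))"

(* Row i of p, for i in V, is row number card {a:V. a < i} of the sub-block p_V. *)
definition rpia_step :: "real mat \<Rightarrow> real mat \<Rightarrow> nat set \<Rightarrow> real mat \<Rightarrow> real mat" where
  "rpia_step A q V p = mat (dim_row p) (dim_col p) (\<lambda>(i, j).
     if i \<in> V then p $$ (i, j) + rpia_correction A q V p $$ (card {a \<in> V. a < i}, j)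
     else p $$ (i, j))"

primrec rpia ::
    "real mat \<Rightarrow> real mat \<Rightarrow> (nat \<Rightarrow> nat set) \<Rightarrow> real mat \<Rightarrow> (nat \<Rightarrow> nat) \<Rightarrow> nat \<Rightarrow> real mat" where
  "rpia A q U p0 s 0 = p0"
| "rpia A q U p0 s (Suc k) = rpia_step A q (U (s k)) (rpia A q U p0 s k)"

definition curve :: "(nat \<Rightarrow> real \<Rightarrow> real) \<Rightarrow> real mat \<Rightarrow> real \<Rightarrow> real vec" where
  "curve \<mu> p y = vec (dim_col p) (\<lambda>j. \<Sum>i<dim_row p. \<mu> i y * p $$ (i, j))"

(* The step in block form: p_V is replaced by p_V + A_V^T r / ||A_V||^2 ... *)
lemma submatrix_rpia_step:
  assumes "dim_col A = dim_row p" "dim_col q = dim_col p" "V \<subseteq> {..<dim_row p}"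
  shows "submatrix (rpia_step A q V p) V UNIV =
           submatrix p V UNIV + rpia_correction A q V p"
proof (rule eq_matI)
  have V: "{i. i < dim_row p \<and> i \<in> V} = V" using assms(3) by auto
  have fin: "finite V" using assms(3) finite_subset by blast
  have dims: "dim_row (rpia_correction A q V p) = card V"
       "dim_col (rpia_correction A q V p) = dim_col p"
    using V assms(1,2) by (auto simp: rpia_correction_def dim_submatrix)
  have st: "dim_row (rpia_step A q V p) = dim_row p" "dim_col (rpia_step A q V p) = dim_col p"
    by (auto simp: rpia_step_def)
  show "dim_row (submatrix (rpia_step A q V p) V UNIV) =
          dim_row (submatrix p V UNIV + rpia_correction A q V p)"
    using V dims st by (simp add: dim_submatrix)
  show "dim_col (submatrix (rpia_step A q V p) V UNIV) =
          dim_col (submatrix p V UNIV + rpia_correction A q V p)"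
    using dims st by (simp add: dim_submatrix)
  fix i j
  assume "i < dim_row (submatrix p V UNIV + rpia_correction A q V p)"
    and "j < dim_col (submatrix p V UNIV + rpia_correction A q V p)"
  then have i: "i < card V" and j: "j < dim_col p" using dims by auto
  have pk: "pick V i \<in> V" using i by (rule pick_in_set_le)
  then have pk': "pick V i < dim_row p" using assms(3) by auto
  have cd: "card {a \<in> V. a < pick V i} = i" using i by (rule card_pick_le)
  show "submatrix (rpia_step A q V p) V UNIV $$ (i, j) =
          (submatrix p V UNIV + rpia_correction A q V p) $$ (i, j)"
    using i j dims st V pk pk' cd
    by (simp add: submatrix_index pick_UNIV) (simp add: rpia_step_def)
qed

(* ... and the control points outside V are kept. *)
lemma row_rpia_step_outside:
  assumes "i < dim_row p" "i \<notin> V"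
  shows "row (rpia_step A q V p) i = row p i"
  using assms by (intro eq_vecI) (auto simp: rpia_step_def)

end

theory Submission
  imports Defs
begin

text \<open>
  A block is drawn with probability \<open>\<parallel>A\<^sub>U\<parallel>\<^sup>2 / D\<close>, where \<open>D = \<parallel>A\<parallel>\<^sup>2\<close> is the squared Frobenius norm, and the step
  on it is scaled by \<open>1 / \<parallel>A\<^sub>U\<parallel>\<^sup>2\<close>. The two factors \<open>\<parallel>A\<^sub>U\<parallel>\<^sup>2\<close> cancel, and since the blocks partition
  the columns, the average over the draw of one random step from \<open>p\<close> is the full gradient step
  \<open>p + A\<^sup>T (q - A p) / D\<close> (lemma \<open>average_rpia_step\<close>).

  This average is affine in \<open>p\<close>, and the draw \<open>\<tau> k\<close> is independent of the earlier draws, which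
  determine the \<open>k\<close>-th iterate (lemma \<open>expectation_fresh_draw\<close>). Hence the expected iterates obey a
  deterministic recursion. By the normal equations \<open>A\<^sup>T A p\<^sup>* = A\<^sup>T q\<close>, each column \<open>v\<close> of the
  difference between the expected iterate and \<open>p\<^sup>*\<close> follows the homogeneous Landweber iteration
  \<open>v \<mapsto> v - A\<^sup>T A v / D\<close>.

  That iteration converges by an energy argument. By Cauchy-Schwarz \<open>\<parallel>A\<^sup>T w\<parallel>\<^sup>2 \<le> D \<parallel>w\<parallel>\<^sup>2\<close>, so a step
  lowers \<open>\<parallel>v\<parallel>\<^sup>2\<close> by at least \<open>\<parallel>A v\<parallel>\<^sup>2 / D\<close>. These decrements are summable, which forces
  \<open>A v \<rightarrow> 0\<close>, and a left inverse of \<open>A\<close>, which full column rank supplies, turns this into \<open>v \<rightarrow> 0\<close>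
  (lemma \<open>landweber_tendsto_0\<close>). The value of a curve at a point is a fixed linear combination of
  its control points, so its expectation converges too.
\<close>

section \<open>Full column rank and the normal equations\<close>

lemma (in vec_space) rank_le_card_cols:
  assumes "A \<in> carrier_mat n nc"
  shows "rank A \<le> card (set (cols A))"
proof -
  obtain T where T: "maximal T (\<lambda>T. T \<subseteq> set (cols A) \<and> lin_indpt T)"
    using maximal_exists[of "(\<lambda>T. T \<subseteq> set (cols A) \<and> lin_indpt T)" "card (set (cols A))" "{}"]
    by (meson List.finite_set card_mono empty_iff empty_subsetI finite_lin_indpt2 rev_finite_subset)
  then have "card T \<le> card (set (cols A))" by (simp add: card_mono maximal_def)
  then show ?thesis using rank_card_indpt[OF assms T] by simp
qed

text \<open>
  The rank is the dimension of the span of the \<^emph>\<open>set\<close> of columns, so a repeated column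
  would already lower it. The columns are therefore distinct, and a nonzero kernel vector would be a
  linear dependence among them.
\<close>

lemma full_column_rank_kernel:
  assumes rank: "full_column_rank A" and v: "v \<in> carrier_vec (dim_col A)"
    and Av: "A *\<^sub>v v = 0\<^sub>v (dim_row A)"
  shows "v = 0\<^sub>v (dim_col A)"
proof (rule ccontr)
  assume nz: "v \<noteq> 0\<^sub>v (dim_col A)"
  have A: "A \<in> carrier_mat (dim_row A) (dim_col A)" by simp
  have r: "vec_space.rank (dim_row A) A = dim_col A"
    using rank by (simp add: full_column_rank_def)
  have "length (cols A) \<le> card (set (cols A))"
    using vec_space.rank_le_card_cols[OF A] r by simp
  then have dist: "distinct (cols A)"
    by (metis card_distinct card_length le_antisym)
  show False
    using vec_space.full_rank_lin_indpt[OF A r dist] vec_space.lin_depI[OF A v nz Av dist] by blast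
qed

text \<open>
  If \<open>A\<^sup>T A v = 0\<close> then \<open>\<parallel>A v\<parallel>\<^sup>2 = v \<bullet> A\<^sup>T A v = 0\<close>, so the Gram matrix has no larger kernel than \<open>A\<close>.
\<close>

lemma gram_mat_inverse:
  fixes A :: "real mat"
  assumes A: "A \<in> carrier_mat nr nc" and rank: "full_column_rank A"
  obtains G where "mat_inverse (transpose_mat A * A) = Some G" "G \<in> carrier_mat nc nc"
    "transpose_mat A * A * G = 1\<^sub>m nc" "G * (transpose_mat A * A) = 1\<^sub>m nc"
proof -
  let ?B = "transpose_mat A * A"
  have B: "?B \<in> carrier_mat nc nc" using A by auto
  have "det ?B \<noteq> 0"
  proof
    assume "det ?B = 0"
    then obtain v where v: "v \<in> carrier_vec nc" "v \<noteq> 0\<^sub>v nc" "?B *\<^sub>v v = 0\<^sub>v nc"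
      using det_0_iff_vec_prod_zero[OF B] by auto
    have w: "A *\<^sub>v v \<in> carrier_vec nr" using A v by auto
    have "(A *\<^sub>v v) \<bullet> (A *\<^sub>v v) = v \<bullet> (transpose_mat A *\<^sub>v (A *\<^sub>v v))"
      using transpose_vec_mult_scalar[OF A v(1) w] by (metis A w comm_scalar_prod mult_mat_vec_carrier transpose_carrier_mat v(1))
    also have "\<dots> = v \<bullet> (?B *\<^sub>v v)"
      using A v(1) by (simp add: assoc_mult_mat_vec[of _ nc nr])
    also have "\<dots> = 0" using v by simp
    finally have "(\<Sum>h<nr. ((A *\<^sub>v v) $ h)\<^sup>2) = 0"
      using w A by (simp add: scalar_prod_def power2_eq_square atLeast0LessThan)
    then have "\<forall>h<nr. (A *\<^sub>v v) $ h = 0"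
      by (subst (asm) sum_nonneg_eq_0_iff) auto
    then have "A *\<^sub>v v = 0\<^sub>v nr" using w A by (intro eq_vecI) auto
    then show False using full_column_rank_kernel[OF rank] v A by auto
  qed
  then have "?B \<in> Units (ring_mat TYPE(real) nc ())" by (rule det_non_zero_imp_unit[OF B])
  then obtain G where "mat_inverse ?B = Some G"
    using mat_inverse(1)[OF B, of "()"] by (cases "mat_inverse ?B") auto
  then show thesis using mat_inverse(2)[OF B] that by blast
qed

lemma least_squares_normal_equations:
  assumes A: "A \<in> carrier_mat nr nc" and rank: "full_column_rank A" and q: "q \<in> carrier_mat nr d"
  shows "least_squares_solution A q \<in> carrier_mat nc d"
    and "transpose_mat A * (A * least_squares_solution A q) = transpose_mat A * q"
proof -
  obtain G where G: "mat_inverse (transpose_mat A * A) = Some G" "G \<in> carrier_mat nc nc"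
    "transpose_mat A * A * G = 1\<^sub>m nc"
    using gram_mat_inverse[OF A rank] by blast
  have At: "transpose_mat A \<in> carrier_mat nc nr" using A by auto
  have Aq: "transpose_mat A * q \<in> carrier_mat nc d" using A q by auto
  have p: "least_squares_solution A q = G * (transpose_mat A * q)"
    by (simp add: least_squares_solution_def G)
  show c: "least_squares_solution A q \<in> carrier_mat nc d"
    using mult_carrier_mat[OF G(2) Aq] by (simp add: p)
  have "transpose_mat A * (A * least_squares_solution A q) =
      transpose_mat A * A * (G * (transpose_mat A * q))"
    unfolding p[symmetric] using assoc_mult_mat[OF At A c] by simp
  also have "\<dots> = transpose_mat A * A * G * (transpose_mat A * q)"
    using assoc_mult_mat[OF mult_carrier_mat[OF At A] G(2) Aq] by simp
  also have "\<dots> = transpose_mat A * q" using left_mult_one_mat[OF Aq] G(3) by simp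
  finally show "transpose_mat A * (A * least_squares_solution A q) = transpose_mat A * q" .
qed

text \<open>
  The pseudoinverse \<open>(A\<^sup>T A)\<^sup>-\<^sup>1 A\<^sup>T\<close> is a witness.
\<close>

lemma full_column_rank_left_inverse:
  assumes A: "A \<in> carrier_mat nr nc" and rank: "full_column_rank A"
  obtains B where "B \<in> carrier_mat nc nr" "B * A = 1\<^sub>m nc"
proof -
  obtain G where G: "G \<in> carrier_mat nc nc" "G * (transpose_mat A * A) = 1\<^sub>m nc"
    using gram_mat_inverse[OF A rank] by blast
  have At: "transpose_mat A \<in> carrier_mat nc nr" using A by auto
  show thesis
    using that[OF mult_carrier_mat[OF G(1) At]] assoc_mult_mat[OF G(1) At A] G(2) by simp
qed

section \<open>Convergence of the Landweber iteration\<close>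

text \<open>
  With \<open>g = A\<^sup>T w\<close>, expanding the square gives \<open>\<parallel>v\<parallel>\<^sup>2 - 2 (v \<bullet> g) / D + \<parallel>g\<parallel>\<^sup>2 / D\<^sup>2\<close>. Here \<open>v \<bullet> g = \<parallel>w\<parallel>\<^sup>2\<close>
  because \<open>w = A v\<close>, and \<open>\<parallel>g\<parallel>\<^sup>2 \<le> D \<parallel>w\<parallel>\<^sup>2\<close> by Cauchy-Schwarz in each coordinate; so the last term
  gives back at most half of what the middle one takes away.
\<close>

lemma landweber_step_decrease:
  fixes a :: "'h \<Rightarrow> 'c \<Rightarrow> real" and v :: "'c \<Rightarrow> real" and H :: "'h set" and C :: "'c set"
  defines "D \<equiv> \<Sum>h\<in>H. \<Sum>c\<in>C. (a h c)\<^sup>2"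
    and "w \<equiv> \<lambda>h. \<Sum>c\<in>C. a h c * v c"
  assumes D: "D > 0"
  shows "(\<Sum>c\<in>C. (v c - (\<Sum>h\<in>H. a h c * w h) / D)\<^sup>2) \<le>
    (\<Sum>c\<in>C. (v c)\<^sup>2) - (\<Sum>h\<in>H. (w h)\<^sup>2) / D"
proof -
  define g where "g = (\<lambda>c. \<Sum>h\<in>H. a h c * w h)"
  define W where "W = (\<Sum>h\<in>H. (w h)\<^sup>2)"
  have "(\<Sum>c\<in>C. v c * g c) = (\<Sum>c\<in>C. \<Sum>h\<in>H. w h * (a h c * v c))"
    unfolding g_def by (simp add: sum_distrib_left mult_ac)
  also have "\<dots> = (\<Sum>h\<in>H. \<Sum>c\<in>C. w h * (a h c * v c))" by (rule sum.swap)
  also have "\<dots> = W"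
    unfolding W_def by (simp add: sum_distrib_left[symmetric] power2_eq_square w_def)
  finally have cross: "(\<Sum>c\<in>C. v c * g c) = W" .
  have "(\<Sum>c\<in>C. (g c)\<^sup>2) \<le> (\<Sum>c\<in>C. (\<Sum>h\<in>H. (a h c)\<^sup>2) * W)"
    unfolding g_def W_def by (intro sum_mono Cauchy_Schwarz_ineq_sum)
  also have "\<dots> = D * W"
    unfolding D_def by (subst sum.swap) (simp add: sum_distrib_right)
  finally have square: "(\<Sum>c\<in>C. (g c)\<^sup>2) \<le> D * W" .
  have "(\<Sum>c\<in>C. (v c - g c / D)\<^sup>2) =
      (\<Sum>c\<in>C. (v c)\<^sup>2 - 2 / D * (v c * g c) + (g c)\<^sup>2 / D\<^sup>2)"
    by (intro sum.cong refl) (simp add: power2_diff power_divide)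
  also have "\<dots> = (\<Sum>c\<in>C. (v c)\<^sup>2) - 2 / D * W + (\<Sum>c\<in>C. (g c)\<^sup>2) / D\<^sup>2"
    by (simp only: sum.distrib sum_subtractf sum_distrib_left[symmetric] cross
        sum_divide_distrib[symmetric])
  also have "\<dots> \<le> (\<Sum>c\<in>C. (v c)\<^sup>2) - 2 / D * W + (D * W) / D\<^sup>2"
    using square D by (intro add_left_mono divide_right_mono) auto
  also have "\<dots> = (\<Sum>c\<in>C. (v c)\<^sup>2) - W / D"
    using D by (simp add: power2_eq_square)
  finally show ?thesis by (simp add: g_def W_def)
qed

text \<open>
  The decrements \<open>\<parallel>w k\<parallel>\<^sup>2 / D\<close> of \<open>\<parallel>v k\<parallel>\<^sup>2\<close> telescope to a convergent series, so the images \<open>w k\<close> of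
  the \<open>v k\<close> tend to zero; the left inverse \<open>b\<close> recovers \<open>v k\<close> from them linearly.
\<close>

lemma landweber_tendsto_0:
  fixes a :: "'h \<Rightarrow> 'c \<Rightarrow> real" and v :: "nat \<Rightarrow> 'c \<Rightarrow> real" and H :: "'h set" and C :: "'c set"
  defines "D \<equiv> \<Sum>h\<in>H. \<Sum>c\<in>C. (a h c)\<^sup>2"
    and "w \<equiv> \<lambda>k h. \<Sum>c\<in>C. a h c * v k c"
  assumes fin: "finite H" "finite C" and D: "D > 0"
    and left_inverse: "\<And>i c. i \<in> C \<Longrightarrow> c \<in> C \<Longrightarrow> (\<Sum>h\<in>H. b i h * a h c) = (if i = c then 1 else 0)"
    and step: "\<And>k c. c \<in> C \<Longrightarrow> v (Suc k) c = v k c - (\<Sum>h\<in>H. a h c * w k h) / D"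
    and i: "i \<in> C"
  shows "(\<lambda>k. v k i) \<longlonglongrightarrow> 0"
proof -
  define S where "S = (\<lambda>k. \<Sum>c\<in>C. (v k c)\<^sup>2)"
  define W where "W = (\<lambda>k. \<Sum>h\<in>H. (w k h)\<^sup>2)"
  have W0: "0 \<le> W k" for k unfolding W_def by (simp add: sum_nonneg)
  have S0: "0 \<le> S k" for k unfolding S_def by (simp add: sum_nonneg)
  have dec: "W k / D \<le> S k - S (Suc k)" for k
  proof -
    have "S (Suc k) = (\<Sum>c\<in>C. (v k c - (\<Sum>h\<in>H. a h c * w k h) / D)\<^sup>2)"
      unfolding S_def by (intro sum.cong refl) (simp only: step)
    also have "\<dots> \<le> S k - W k / D"
      unfolding S_def W_def w_def D_def by (rule landweber_step_decrease) (rule D[unfolded D_def])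
    finally show ?thesis by simp
  qed
  have "(\<Sum>k<n. W k / D) \<le> S 0" for n
  proof -
    have "(\<Sum>k<n. W k / D) \<le> (\<Sum>k<n. S k - S (Suc k))" by (intro sum_mono dec)
    also have "\<dots> = S 0 - S n" by (rule sum_lessThan_telescope')
    finally show ?thesis using S0[of n] by simp
  qed
  then have "summable (\<lambda>k. W k / D)"
    using W0 D by (intro summableI_nonneg_bounded[where x = "S 0"]) auto
  from summable_LIMSEQ_zero[OF this] have "(\<lambda>k. W k / D * D) \<longlonglongrightarrow> 0 * D"
    by (rule tendsto_mult_right)
  then have W: "W \<longlonglongrightarrow> 0" using D by simp
  have w: "(\<lambda>k. w k h) \<longlonglongrightarrow> 0" if h: "h \<in> H" for h
  proof -
    have "\<bar>w k h\<bar> \<le> sqrt (W k)" for k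
      unfolding W_def using fin h
      by (intro real_le_rsqrt) (simp, rule member_le_sum, auto)
    moreover have "(\<lambda>k. sqrt (W k)) \<longlonglongrightarrow> 0"
      using tendsto_real_sqrt[OF W] by simp
    ultimately show ?thesis
      using Lim_null_comparison[of "\<lambda>k. w k h" "\<lambda>k. sqrt (W k)" sequentially] by simp
  qed
  have "v k i = (\<Sum>h\<in>H. b i h * w k h)" for k
  proof -
    have "(\<Sum>h\<in>H. b i h * w k h) = (\<Sum>h\<in>H. \<Sum>c\<in>C. b i h * a h c * v k c)"
      unfolding w_def by (simp only: sum_distrib_left mult.assoc)
    also have "\<dots> = (\<Sum>c\<in>C. \<Sum>h\<in>H. b i h * a h c * v k c)" by (rule sum.swap)
    also have "\<dots> = (\<Sum>c\<in>C. (\<Sum>h\<in>H. b i h * a h c) * v k c)"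
      by (simp only: sum_distrib_right)
    also have "\<dots> = (\<Sum>c\<in>C. if i = c then v k c else 0)"
      by (intro sum.cong refl) (simp add: left_inverse i)
    also have "\<dots> = v k i" using fin i by simp
    finally show ?thesis by simp
  qed
  moreover have "(\<lambda>k. \<Sum>h\<in>H. b i h * w k h) \<longlonglongrightarrow> (\<Sum>h\<in>H. b i h * 0)"
    by (intro tendsto_sum tendsto_mult_left w)
  ultimately show ?thesis by simp
qed

section \<open>The average of one block step\<close>

lemma frobenius_norm_submatrix_sq:
  assumes "V \<subseteq> {..<dim_col A}"
  shows "(frobenius_norm (submatrix A UNIV V))\<^sup>2 = (\<Sum>h<dim_row A. \<Sum>c\<in>V. (A $$ (h, c))\<^sup>2)"
proof -
  have fin: "finite V" using assms finite_subset by blast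
  have V: "{j. j < dim_col A \<and> j \<in> V} = V" using assms by auto
  have bij: "bij_betw (pick V) {..<card V} V"
  proof (rule bij_betwI[where g = "\<lambda>i. card {a \<in> V. a < i}"])
    show "(\<lambda>i. card {a \<in> V. a < i}) \<in> V \<rightarrow> {..<card V}"
      using fin by (auto intro!: psubset_card_mono)
  qed (auto simp: pick_in_set_le card_pick_le pick_card_in_set)
  have "(frobenius_norm (submatrix A UNIV V))\<^sup>2 =
      (\<Sum>h<dim_row A. \<Sum>c<card V. (A $$ (h, pick V c))\<^sup>2)"
    unfolding frobenius_norm_def
    by (subst real_sqrt_pow2) (auto simp: sum_nonneg dim_submatrix V submatrix_index pick_UNIV)
  also have "\<dots> = (\<Sum>h<dim_row A. \<Sum>c\<in>V. (A $$ (h, c))\<^sup>2)"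
    by (intro sum.cong refl sum.reindex_bij_betw bij)
  finally show ?thesis .
qed

text \<open>
  Row number \<open>card {a \<in> V. a < i}\<close> of the block belongs to the control point \<open>i\<close>. For a column \<open>i\<close>
  in the block, the block gradient thus agrees with the corresponding entry of the full gradient.
\<close>

lemma submatrix_transpose_mult_index:
  assumes V: "V \<subseteq> {..<dim_col A}" and i: "i \<in> V" and r: "dim_row r = dim_row A" and j: "j < dim_col r"
  shows "(transpose_mat (submatrix A UNIV V) * r) $$ (card {a \<in> V. a < i}, j) =
    (transpose_mat A * r) $$ (i, j)"
proof -
  have fin: "finite V" using V finite_subset by blast
  have V': "{j. j < dim_col A \<and> j \<in> V} = V" using V by auto
  have lt: "card {a \<in> V. a < i} < card V"
    using fin i by (auto intro!: psubset_card_mono)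
  have il: "i < dim_col A" using V i by auto
  show ?thesis
    using r j lt il i
    by (auto simp: scalar_prod_def dim_submatrix V' submatrix_index pick_UNIV pick_card_in_set intro!: sum.cong)
qed

lemma frobenius_norm_submatrix_nonzero:
  assumes V: "V \<subseteq> {..<dim_col A}" "V \<noteq> {}"
    and cols: "\<And>c. c < dim_col A \<Longrightarrow> \<exists>h<dim_row A. A $$ (h, c) \<noteq> 0"
  shows "frobenius_norm (submatrix A UNIV V) \<noteq> 0"
proof -
  have fin: "finite V" using V finite_subset by blast
  obtain c where c: "c \<in> V" using V by auto
  then obtain h where h: "h < dim_row A" "A $$ (h, c) \<noteq> 0" using cols V by auto
  have "0 < (\<Sum>c\<in>V. (A $$ (h, c))\<^sup>2)" using c h fin by (intro sum_pos2[of _ c]) auto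
  then have "0 < (\<Sum>h<dim_row A. \<Sum>c\<in>V. (A $$ (h, c))\<^sup>2)"
    using h by (intro sum_pos2[where i = h and I = "{..<dim_row A}"]) (auto intro: sum_nonneg)
  then show ?thesis using frobenius_norm_submatrix_sq[OF V(1)] by auto
qed

lemma sum_frobenius_norm_blocks:
  assumes part: "is_index_partition n t U" and A: "dim_col A = n + 1"
  shows "(\<Sum>l\<le>t. (frobenius_norm (submatrix A UNIV (U l)))\<^sup>2) =
    (\<Sum>h<dim_row A. \<Sum>c<n + 1. (A $$ (h, c))\<^sup>2)"
proof -
  have un: "(\<Union>l\<le>t. U l) = {..<n + 1}" and dj: "disjoint_family_on U {..t}"
    using part by (auto simp: is_index_partition_def)
  have sub: "U l \<subseteq> {..<n + 1}" if "l \<le> t" for l using un that by auto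
  have "(\<Sum>l\<le>t. (frobenius_norm (submatrix A UNIV (U l)))\<^sup>2) =
      (\<Sum>l\<le>t. \<Sum>h<dim_row A. \<Sum>c\<in>U l. (A $$ (h, c))\<^sup>2)"
    using sub A by (intro sum.cong refl frobenius_norm_submatrix_sq) auto
  also have "\<dots> = (\<Sum>h<dim_row A. \<Sum>l\<le>t. \<Sum>c\<in>U l. (A $$ (h, c))\<^sup>2)" by (rule sum.swap)
  also have "\<dots> = (\<Sum>h<dim_row A. \<Sum>c\<in>(\<Union>l\<le>t. U l). (A $$ (h, c))\<^sup>2)"
    using sub dj
    by (intro sum.cong refl sum.UNION_disjoint[symmetric]) 
      (auto simp: disjoint_family_on_def intro: finite_subset)
  finally show ?thesis by (simp add: un)
qed

text \<open>
  Exactly one block \<open>l0\<close> contains \<open>i\<close>, so the drawn step changes entry \<open>i\<close> only when \<open>l = l0\<close>. The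
  probability of that is \<open>F l0 / D\<close> and the change is \<open>g / F l0\<close>, which contributes \<open>g / D\<close>
  whichever block it is. The columns are assumed nonzero so that \<open>F l0\<close> may be cancelled.
\<close>

lemma average_rpia_step:
  assumes part: "is_index_partition n t U"
    and A: "A \<in> carrier_mat r (n + 1)" and q: "q \<in> carrier_mat r d" and p: "p \<in> carrier_mat (n + 1) d"
    and cols: "\<And>c. c \<le> n \<Longrightarrow> \<exists>h<r. A $$ (h, c) \<noteq> 0"
    and i: "i \<le> n" and j: "j < d"
  shows "(\<Sum>l\<le>t. block_prob A U t l * rpia_step A q (U l) p $$ (i, j)) =
    p $$ (i, j) + (transpose_mat A * (q - A * p)) $$ (i, j) / (\<Sum>h<r. \<Sum>c<n + 1. (A $$ (h, c))\<^sup>2)"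
proof -
  have un: "(\<Union>l\<le>t. U l) = {..<n + 1}" and dj: "disjoint_family_on U {..t}"
    and ne: "\<And>l. l \<le> t \<Longrightarrow> U l \<noteq> {}"
    using part by (auto simp: is_index_partition_def)
  have sub: "U l \<subseteq> {..<dim_col A}" if "l \<le> t" for l using un that A by auto
  define F where "F = (\<lambda>l. (frobenius_norm (submatrix A UNIV (U l)))\<^sup>2)"
  define D where "D = (\<Sum>l\<le>t. F l)"
  define g where "g = (transpose_mat A * (q - A * p)) $$ (i, j)"
  have D: "D = (\<Sum>h<r. \<Sum>c<n + 1. (A $$ (h, c))\<^sup>2)"
    using sum_frobenius_norm_blocks[OF part, of A] A by (simp add: D_def F_def)
  have F: "F l > 0" if "l \<le> t" for l
    using frobenius_norm_submatrix_nonzero[OF sub[OF that] ne[OF that]] cols A by (simp add: F_def)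
  then have Dpos: "D > 0" unfolding D_def by (intro sum_pos2[of _ 0]) (auto intro: less_imp_le)
  have bp: "block_prob A U t l = F l / D" for l by (simp add: block_prob_def F_def D_def)
  obtain l0 where l0: "l0 \<le> t" "i \<in> U l0"
  proof -
    have "i \<in> (\<Union>l\<le>t. U l)" unfolding un using i by simp
    then show thesis using that by auto
  qed
  have uniq: "i \<in> U l \<longleftrightarrow> l = l0" if "l \<le> t" for l
    using dj l0 that by (auto simp: disjoint_family_on_def)
  have st: "rpia_step A q (U l) p $$ (i, j) = p $$ (i, j) + (if l = l0 then g / F l else 0)"
    if l: "l \<le> t" for l
  proof (cases "l = l0")
    case True
    have V: "{c. c < dim_col A \<and> c \<in> U l} = U l" using sub[OF l] by auto
    have iU: "i \<in> U l" using True l0 by simp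
    have fin: "finite (U l)" using sub[OF l] finite_subset by blast
    have lt: "card {a \<in> U l. a < i} < card (U l)"
      using fin iU by (auto intro!: psubset_card_mono)
    have "(transpose_mat (submatrix A UNIV (U l)) * (q - A * p)) $$ (card {a \<in> U l. a < i}, j) = g"
      unfolding g_def using A q p j by (intro submatrix_transpose_mult_index[OF sub[OF l] iU]) auto
    moreover have "transpose_mat (submatrix A UNIV (U l)) * (q - A * p) \<in> carrier_mat (card (U l)) d"
      using A q p V by (intro carrier_matI) (auto simp: dim_submatrix)
    ultimately have "rpia_correction A q (U l) p $$ (card {a \<in> U l. a < i}, j) = g / F l"
      unfolding rpia_correction_def F_def using lt j by (subst index_smult_mat) auto
    then show ?thesis using True iU i j p by (simp add: rpia_step_def)
  next
    case False
    then show ?thesis using uniq[OF l] i j p by (simp add: rpia_step_def)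
  qed
  have "(\<Sum>l\<le>t. block_prob A U t l * rpia_step A q (U l) p $$ (i, j)) =
      (\<Sum>l\<le>t. F l * p $$ (i, j) / D + (if l = l0 then g / D else 0))"
  proof (intro sum.cong refl)
    fix l assume "l \<in> {..t}"
    then have l: "l \<le> t" by simp
    show "block_prob A U t l * rpia_step A q (U l) p $$ (i, j) =
        F l * p $$ (i, j) / D + (if l = l0 then g / D else 0)"
      unfolding st[OF l] bp using F[OF l] by (cases "l = l0") (simp_all add: distrib_left)
  qed
  also have "\<dots> = (\<Sum>l\<le>t. F l) * p $$ (i, j) / D + g / D"
    using l0 by (simp add: sum.distrib sum_distrib_right sum_divide_distrib)
  also have "\<dots> = p $$ (i, j) + g / D" using Dpos by (simp add: D_def)
  finally show ?thesis by (simp add: g_def D)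
qed

section \<open>Averaging over a fresh draw\<close>

lemma (in finite_measure) integrable_finite_range:
  fixes f :: "'b \<Rightarrow> real"
  assumes X: "X \<in> measurable M (count_space S)" and S: "finite S"
  shows "integrable M (\<lambda>\<omega>. f (X \<omega>))"
proof (rule integrable_const_bound[where B = "\<Sum>s\<in>S. \<bar>f s\<bar>"])
  show "AE \<omega> in M. norm (f (X \<omega>)) \<le> (\<Sum>s\<in>S. \<bar>f s\<bar>)"
  proof (rule AE_I2)
    fix \<omega> assume "\<omega> \<in> space M"
    then have "X \<omega> \<in> S" using measurable_space[OF X] by simp
    then show "norm (f (X \<omega>)) \<le> (\<Sum>s\<in>S. \<bar>f s\<bar>)"
      using S member_le_sum[of "X \<omega>" S "\<lambda>s. \<bar>f s\<bar>"] by simp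
  qed
  show "(\<lambda>\<omega>. f (X \<omega>)) \<in> borel_measurable M"
    using measurable_compose[OF X, of f borel] by simp
qed

text \<open>
  Finitely many draws from a finite set have only finitely many outcomes. With the discrete
  \<open>\<sigma>\<close>-algebra on them, every function of these draws is measurable and bounded.
\<close>

lemma (in prob_space) measurable_restrict_draws:
  assumes "indep_vars (\<lambda>_. count_space {..t::nat}) \<tau> (UNIV :: nat set)" and "finite K"
  shows "(\<lambda>\<omega>. restrict (\<lambda>l. \<tau> l \<omega>) K) \<in> measurable M (count_space (PiE K (\<lambda>_. {..t})))"
proof -
  have "(\<lambda>\<omega>. restrict (\<lambda>l. \<tau> l \<omega>) K) \<in> measurable M (PiM K (\<lambda>_. count_space {..t}))"
    using assms by (intro measurable_restrict) (auto simp: indep_vars_def)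
  then show ?thesis using assms by (simp add: count_space_PiM_finite)
qed

text \<open>
  The law of total expectation, conditioning on the draw at time \<open>k\<close>: as \<open>\<tau> k\<close> is independent of
  the earlier draws, conditioning on \<open>\<tau> k = i\<close> leaves their distribution unchanged. It follows by
  splitting the integrand along the indicators of the events \<open>\<tau> k = i\<close>.
\<close>

lemma (in prob_space) expectation_fresh_draw:
  fixes F :: "nat \<Rightarrow> (nat \<Rightarrow> nat) \<Rightarrow> real"
  assumes indep: "indep_vars (\<lambda>_. count_space {..t::nat}) \<tau> (UNIV :: nat set)"
  shows "expectation (\<lambda>\<omega>. F (\<tau> k \<omega>) (restrict (\<lambda>l. \<tau> l \<omega>) {..<k})) =
    (\<Sum>i\<le>t. prob {\<omega> \<in> space M. \<tau> k \<omega> = i} * expectation (\<lambda>\<omega>. F i (restrict (\<lambda>l. \<tau> l \<omega>) {..<k})))"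
proof -
  define X where "X = (\<lambda>\<omega>. restrict (\<lambda>l. \<tau> l \<omega>) {..<k})"
  have X: "X \<in> measurable M (count_space (PiE {..<k} (\<lambda>_. {..t})))"
    unfolding X_def by (rule measurable_restrict_draws[OF indep]) simp
  have \<tau>: "\<tau> k \<in> measurable M (count_space {..t})"
    using indep by (auto simp: indep_vars_def)
  have FX: "integrable M (\<lambda>\<omega>. F i (X \<omega>))" for i
    using X by (rule integrable_finite_range) (auto intro: finite_PiE)
  have I: "integrable M (\<lambda>\<omega>. indicator {i} (\<tau> k \<omega>) :: real)" for i
    using \<tau> by (rule integrable_finite_range) auto
  have "indep_var (count_space (PiE {k} (\<lambda>_. {..t}))) (\<lambda>\<omega>. restrict (\<lambda>l. \<tau> l \<omega>) {k})
      (count_space (PiE {..<k} (\<lambda>_. {..t}))) X"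
    using indep_var_restrict[OF indep, of "{k}" "{..<k}"] by (simp add: count_space_PiM_finite X_def)
  then have ind: "indep_var borel (\<lambda>\<omega>. indicator {i} (\<tau> k \<omega>) :: real) borel (\<lambda>\<omega>. F i (X \<omega>))" for i
    using indep_var_compose[where ?Y1.0 = "\<lambda>s. indicator {i} (s k)" and ?N1.0 = borel
        and ?Y2.0 = "F i" and ?N2.0 = borel] by (fastforce simp: comp_def)
  have pr: "expectation (\<lambda>\<omega>. indicator {i} (\<tau> k \<omega>) :: real) = prob {\<omega> \<in> space M. \<tau> k \<omega> = i}" for i
  proof -
    have "expectation (\<lambda>\<omega>. indicator {i} (\<tau> k \<omega>) :: real) =
        expectation (indicator {\<omega> \<in> space M. \<tau> k \<omega> = i} :: _ \<Rightarrow> real)"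
      by (intro Bochner_Integration.integral_cong) (auto simp: indicator_def)
    also have "\<dots> = prob ({\<omega> \<in> space M. \<tau> k \<omega> = i} \<inter> space M)" by simp
    also have "{\<omega> \<in> space M. \<tau> k \<omega> = i} \<inter> space M = {\<omega> \<in> space M. \<tau> k \<omega> = i}" by auto
    finally show ?thesis .
  qed
  have "expectation (\<lambda>\<omega>. F (\<tau> k \<omega>) (X \<omega>)) =
      expectation (\<lambda>\<omega>. \<Sum>i\<le>t. indicator {i} (\<tau> k \<omega>) * F i (X \<omega>))"
  proof (rule Bochner_Integration.integral_cong[OF refl])
    fix \<omega> assume "\<omega> \<in> space M"
    then have "\<tau> k \<omega> \<le> t" using measurable_space[OF \<tau>] by auto
    then show "F (\<tau> k \<omega>) (X \<omega>) = (\<Sum>i\<le>t. indicator {i} (\<tau> k \<omega>) * F i (X \<omega>))"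
      by (subst sum.remove[of _ "\<tau> k \<omega>"]) (auto simp: indicator_def)
  qed
  also have "\<dots> = (\<Sum>i\<le>t. expectation (\<lambda>\<omega>. indicator {i} (\<tau> k \<omega>) * F i (X \<omega>)))"
    by (intro Bochner_Integration.integral_sum indep_var_integrable[OF ind I FX])
  also have "\<dots> = (\<Sum>i\<le>t. expectation (\<lambda>\<omega>. indicator {i} (\<tau> k \<omega>)) * expectation (\<lambda>\<omega>. F i (X \<omega>)))"
    by (intro sum.cong refl indep_var_lebesgue_integral[OF ind I FX])
  finally show ?thesis by (simp add: X_def pr)
qed

section \<open>Convergence in expectation\<close>

lemma rpia_carrier: "p0 \<in> carrier_mat r d \<Longrightarrow> rpia A q U p0 s k \<in> carrier_mat r d"
  by (induction k) (auto simp: rpia_step_def)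

lemma rpia_cong: "(\<And>l. l < k \<Longrightarrow> s l = s' l) \<Longrightarrow> rpia A q U p0 s k = rpia A q U p0 s' k"
  by (induction k) auto

text \<open>
  With \<open>mean j k\<close> denoting column \<open>j\<close> of the expected \<open>k\<close>-th iterate, the recursion \<open>step\<close> below is the
  Landweber iteration for its distance to \<open>p\<^sup>*\<close>.
\<close>

theorem theorem4p1:
  fixes \<mu> :: "nat \<Rightarrow> real \<Rightarrow> real"
    and x :: "nat \<Rightarrow> real"
    and q :: "nat \<Rightarrow> real vec"
    and lam :: real
    and U :: "nat \<Rightarrow> nat set"
    and \<Gamma> p0 :: "real mat"
    and m n\<^sub>1 t d :: nat
    and M :: "'w measure"
    and \<tau> :: "nat \<Rightarrow> 'w \<Rightarrow> nat"
  defines "A \<equiv> augmented_matrix lam (collocation_matrix m n\<^sub>1 \<mu> x) \<Gamma>"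
    and "qh \<equiv> augmented_data m n\<^sub>1 d q"
  defines "P \<equiv> (\<lambda>k \<omega>. rpia A qh U p0 (\<lambda>l. \<tau> l \<omega>) k)"
    and "pstar \<equiv> least_squares_solution A qh"
  assumes nodes: "strict_mono_on {0..m} x" "x ` {0..m} \<subseteq> {0..1}"
    and data: "\<forall>h\<le>m. q h \<in> carrier_vec d"
    and lam: "0 \<le> lam"
    and partition: "is_index_partition n\<^sub>1 t U"
    and gamma: "second_difference_matrix n\<^sub>1 \<Gamma>"
    and rank: "full_column_rank A"
    and more_data: "m + 1 > n\<^sub>1 + 1"
    and init: "p0 \<in> carrier_mat (n\<^sub>1 + 1) d"
    and prob: "prob_space M"
    and indep: "prob_space.indep_vars M (\<lambda>_. count_space {..t}) \<tau> UNIV"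
    and distr: "\<forall>k. \<forall>i\<le>t. measure M {\<omega> \<in> space M. \<tau> k \<omega> = i} = block_prob A U t i"
  shows "(\<forall>i\<le>n\<^sub>1. \<forall>j<d.
            (\<forall>k. integrable M (\<lambda>\<omega>. P k \<omega> $$ (i, j))) \<and>
            (\<lambda>k. \<integral>\<omega>. P k \<omega> $$ (i, j) \<partial>M) \<longlonglongrightarrow> pstar $$ (i, j)) \<and>
         (\<forall>y\<in>{x 0..x m}. \<forall>j<d.
            (\<forall>k. integrable M (\<lambda>\<omega>. curve \<mu> (P k \<omega>) y $ j)) \<and>
            (\<lambda>k. \<integral>\<omega>. curve \<mu> (P k \<omega>) y $ j \<partial>M) \<longlonglongrightarrow> curve \<mu> pstar y $ j)"
proof -
  interpret prob_space M by (rule prob)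
  define N where "N = n\<^sub>1 + 1"
  define R where "R = m + 1 + (n\<^sub>1 + 1)"
  have A: "A \<in> carrier_mat R N"
    using gamma unfolding A_def augmented_matrix_def second_difference_matrix_def
      collocation_matrix_def R_def N_def
    by (intro carrier_append_rows) auto
  have q: "qh \<in> carrier_mat R d"
    unfolding qh_def augmented_data_def R_def
    by (intro carrier_append_rows) (auto simp: mat_of_rows_def)
  have pstar: "pstar \<in> carrier_mat N d"
    and normal: "transpose_mat A * (A * pstar) = transpose_mat A * qh"
    unfolding pstar_def using least_squares_normal_equations[OF A rank q] by auto
  obtain B where B: "B \<in> carrier_mat N R" "B * A = 1\<^sub>m N"
    using full_column_rank_left_inverse[OF A rank] by blast
  have BA: "(\<Sum>h<R. B $$ (i, h) * A $$ (h, c)) = (if i = c then 1 else 0)" if "i < N" "c < N" for i c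
  proof -
    have "(\<Sum>h<R. B $$ (i, h) * A $$ (h, c)) = (B * A) $$ (i, c)"
      using A B(1) that by (simp add: scalar_prod_def atLeast0LessThan)
    then show ?thesis using B that by simp
  qed
  have cols: "\<exists>h<R. A $$ (h, c) \<noteq> 0" if "c < N" for c
    \<comment> \<open>A zero column \<open>c\<close> of \<open>A\<close> would make the entry \<open>(c, c)\<close> of \<open>B * A = 1\<close> vanish.\<close>
  proof (rule ccontr)
    assume "\<not> (\<exists>h<R. A $$ (h, c) \<noteq> 0)"
    then have "(\<Sum>h<R. B $$ (c, h) * A $$ (h, c)) = 0" by (intro sum.neutral) auto
    then show False using BA[of c c] that by simp
  qed
  define D where "D = (\<Sum>h<R. \<Sum>c<N. (A $$ (h, c))\<^sup>2)"
  have D: "D > 0"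
  proof -
    obtain h where h: "h < R" "A $$ (h, 0) \<noteq> 0" using cols[of 0] by (auto simp: N_def)
    have "0 < (\<Sum>c<N. (A $$ (h, c))\<^sup>2)" using h by (intro sum_pos2[where i = 0]) (auto simp: N_def)
    then show ?thesis unfolding D_def using h by (intro sum_pos2[where i = h and I = "{..<R}"]) (auto intro: sum_nonneg)
  qed
  \<comment> \<open>The \<open>k\<close>-th iterate depends on the draws before time \<open>k\<close> only, hence takes finitely many values.\<close>
  define X where "X = (\<lambda>k \<omega>. restrict (\<lambda>l. \<tau> l \<omega>) {..<k})"
  have X: "X k \<in> measurable M (count_space (PiE {..<k} (\<lambda>_. {..t})))" for k
    unfolding X_def by (rule measurable_restrict_draws[OF indep]) simp
  have PX: "P k \<omega> = rpia A qh U p0 (X k \<omega>) k" for k \<omega>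
    unfolding P_def X_def by (rule rpia_cong) simp
  have P: "P k \<omega> \<in> carrier_mat N d" for k \<omega>
    unfolding P_def by (rule rpia_carrier[OF init[folded N_def]])
  have int: "integrable M (\<lambda>\<omega>. f (P k \<omega>) :: real)" for f k
    unfolding PX by (rule integrable_finite_range[OF X]) (auto intro: finite_PiE)
  define mean where "mean = (\<lambda>j k c. \<integral>\<omega>. P k \<omega> $$ (c, j) \<partial>M)"
  \<comment> \<open>The normal equations replace \<open>A\<^sup>T q\<close> by \<open>A\<^sup>T A p\<^sup>*\<close>, so the gradient sees only the error \<open>p - p\<^sup>*\<close>.\<close>
  have gradient: "(transpose_mat A * (qh - A * p)) $$ (i, j) =
      - (\<Sum>h<R. A $$ (h, i) * (\<Sum>c<N. A $$ (h, c) * (p $$ (c, j) - pstar $$ (c, j))))"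
    if p: "p \<in> carrier_mat N d" and ij: "i < N" "j < d" for p i j
  proof -
    have At: "transpose_mat A \<in> carrier_mat N R" using A by simp
    have "transpose_mat A * (qh - A * p) = transpose_mat A * (A * pstar) - transpose_mat A * (A * p)"
      using mult_minus_distrib_mat[OF At q mult_carrier_mat[OF A p]] normal by simp
    then show ?thesis
      using A p pstar ij
      by (simp add: scalar_prod_def atLeast0LessThan sum_subtractf right_diff_distrib)
  qed
  have step: "mean j (Suc k) i = mean j k i -
      (\<Sum>h<R. A $$ (h, i) * (\<Sum>c<N. A $$ (h, c) * (mean j k c - pstar $$ (c, j)))) / D"
    if ij: "i < N" "j < d" for i j k
  proof -
    define F where "F = (\<lambda>l s. rpia_step A qh (U l) (rpia A qh U p0 s k) $$ (i, j))"
    have "mean j (Suc k) i = expectation (\<lambda>\<omega>. F (\<tau> k \<omega>) (X k \<omega>))"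
      unfolding mean_def F_def PX[symmetric] by (simp add: P_def)
    also have "\<dots> = (\<Sum>l\<le>t. prob {\<omega> \<in> space M. \<tau> k \<omega> = l} * expectation (\<lambda>\<omega>. F l (X k \<omega>)))"
      unfolding X_def by (rule expectation_fresh_draw[OF indep])
    also have "\<dots> = (\<Sum>l\<le>t. expectation (\<lambda>\<omega>. block_prob A U t l * rpia_step A qh (U l) (P k \<omega>) $$ (i, j)))"
      using distr by (intro sum.cong refl) (simp add: F_def PX)
    also have "\<dots> = expectation (\<lambda>\<omega>. \<Sum>l\<le>t. block_prob A U t l * rpia_step A qh (U l) (P k \<omega>) $$ (i, j))"
      by (rule Bochner_Integration.integral_sum[symmetric]) (rule int)
    also have "\<dots> = expectation (\<lambda>\<omega>. P k \<omega> $$ (i, j) -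
        (\<Sum>h<R. A $$ (h, i) * (\<Sum>c<N. A $$ (h, c) * (P k \<omega> $$ (c, j) - pstar $$ (c, j)))) / D)"
    proof (intro Bochner_Integration.integral_cong refl)
      fix \<omega>
      have "(\<Sum>l\<le>t. block_prob A U t l * rpia_step A qh (U l) (P k \<omega>) $$ (i, j)) =
          P k \<omega> $$ (i, j) + (transpose_mat A * (qh - A * P k \<omega>)) $$ (i, j) / D"
        unfolding D_def N_def
        using average_rpia_step[OF partition A[unfolded N_def] q P[unfolded N_def]] cols ij
        by (simp add: N_def del: sum.lessThan_Suc)
      then show "(\<Sum>l\<le>t. block_prob A U t l * rpia_step A qh (U l) (P k \<omega>) $$ (i, j)) =
          P k \<omega> $$ (i, j) -
          (\<Sum>h<R. A $$ (h, i) * (\<Sum>c<N. A $$ (h, c) * (P k \<omega> $$ (c, j) - pstar $$ (c, j)))) / D"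
        using gradient[OF P ij] by simp
    qed
    also have "\<dots> = mean j k i -
        (\<Sum>h<R. A $$ (h, i) * (\<Sum>c<N. A $$ (h, c) * (mean j k c - pstar $$ (c, j)))) / D"
      using int[of "\<lambda>p. p $$ (c, j)" k for c] by (simp add: mean_def prob_space)
    finally show ?thesis .
  qed
  have lim: "(\<lambda>k. mean j k i) \<longlonglongrightarrow> pstar $$ (i, j)" if ij: "i < N" "j < d" for i j
  proof -
    have "(\<lambda>k. mean j k i - pstar $$ (i, j)) \<longlonglongrightarrow> 0"
      using landweber_tendsto_0[where a = "\<lambda>h c. A $$ (h, c)" and H = "{..<R}" and C = "{..<N}"
          and b = "\<lambda>c h. B $$ (c, h)" and v = "\<lambda>k c. mean j k c - pstar $$ (c, j)" and i = i,
          folded D_def]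
        D BA step ij by simp
    then show ?thesis by (rule LIM_zero_cancel)
  qed
  have "(\<lambda>k. \<integral>\<omega>. curve \<mu> (P k \<omega>) y $ j \<partial>M) \<longlonglongrightarrow> curve \<mu> pstar y $ j" if j: "j < d" for y j
  proof -
    have c: "curve \<mu> p y $ j = (\<Sum>i<N. \<mu> i y * p $$ (i, j))" if "p \<in> carrier_mat N d" for p
      using that j by (auto simp: curve_def)
    have "(\<integral>\<omega>. curve \<mu> (P k \<omega>) y $ j \<partial>M) = (\<Sum>i<N. \<mu> i y * mean j k i)" for k
      unfolding c[OF P] mean_def by (subst Bochner_Integration.integral_sum) (auto intro: int)
    then show ?thesis
      unfolding c[OF pstar] using j by (auto intro!: tendsto_sum tendsto_mult_left lim)
  qed
  then show ?thesis using int lim by (auto simp: mean_def N_def less_Suc_eq_le)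
qed

end
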